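(* Let $p\colon(\tilde Q,\tilde q)\to(Q,q)$ be a quandle covering and let $f\colon(X,x)\to(Q,q)$ be a quandle homomorphism of pointed quandles, where $X$ is a connected quandle. Then there exists a lifting of $f$ over $p$, that is, a quandle homomorphism $\tilde f\colon(X,x)\to(\tilde Q,\tilde q)$ with $p\circ\tilde f=f$, if and only if $f_*\pi_1(X,x)\subset p_*\pi_1(\tilde Q,\tilde q)$. In this case the lifting $\tilde f$ is unique.
   Context: A quandle is a set $Q$ with two binary operations $*,\bar{*}$ such that for all $a,b,c\in Q$: $a*a=a$; $(a*b)\bar{*}b=a=(a\bar{*}b)*b$; $(a*b)*c=(a*c)*(b*c)$. A quandle homomorphism is a map preserving $*$ (hence $\bar{*}$). Maps of pointed quandles preserve base points. $\mathrm{Inn}(Q)$ is the group of automorphisms of $Q$ generated by the right translations $x\mapsto x*a$ ($a\in Q$); $Q$ is connected if $\mathrm{Inn}(Q)$ acts transitively on $Q$. A quandle homomorphism $p\colon\tilde Q\to Q$ is a covering if it is surjective and $p(\tilde y)=p(\tilde z)$ implies $\tilde x*\tilde y=\tilde x*\tilde z$ for all $\tilde x,\tilde y,\tilde z\in\tilde Q$. The adjoint group $\mathrm{Adj}(Q)$ is generated by symbols $\mathrm{adj}(a)$, $a\in Q$, subject to $\mathrm{adj}(a*b)=\mathrm{adj}(b)^{-1}\mathrm{adj}(a)\,\mathrm{adj}(b)$. It acts on $Q$ from the right by quandle automorphisms with $a^{\mathrm{adj}(b)}=a*b$. A quandle homomorphism $f\colon Q\to Q'$ induces $\mathrm{Adj}(f)\colon\mathrm{Adj}(Q)\to\mathrm{Adj}(Q')$,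 $\mathrm{adj}(a)\mapsto\mathrm{adj}(f(a))$. Let $\varepsilon\colon\mathrm{Adj}(Q)\to\mathbb{Z}$ be the homomorphism with $\varepsilon(\mathrm{adj}(a))=1$ for all $a$, and $\mathrm{Adj}(Q)^\circ=\ker\varepsilon$. The fundamental group is $\pi_1(Q,q)=\{g\in\mathrm{Adj}(Q)^\circ\mid q^g=q\}$, and for $f\colon(Q,q)\to(Q',q')$ the map $f_*\colon\pi_1(Q,q)\to\pi_1(Q',q')$ is the restriction of $\mathrm{Adj}(f)$. *)

theory Defs
  imports "HOL-Algebra.Group_Action" "HOL-Algebra.Generated_Groups" "HOL-Algebra.Elementary_Groups"
begin

section \<open>Quandles\<close>

text \<open>\<open>a \<triangleright> b\<close> is \<open>a * b\<close> and \<open>a \<triangleleft> b\<close> is the inverse operation. The operations and all maps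
  are total HOL functions, relevant only on carriers.\<close>

record 'a quandle = "'a partial_object" +
  qop :: "'a \<Rightarrow> 'a \<Rightarrow> 'a" (infixl \<open>\<triangleright>\<index>\<close> 70)
  qinv :: "'a \<Rightarrow> 'a \<Rightarrow> 'a" (infixl \<open>\<triangleleft>\<index>\<close> 70)

locale quandle =
  fixes Q :: "('a, 'm) quandle_scheme" (structure)
  assumes qop_closed [simp, intro]: "\<lbrakk>a \<in> carrier Q; b \<in> carrier Q\<rbrakk> \<Longrightarrow> a \<triangleright> b \<in> carrier Q"
    and qinv_closed [simp, intro]: "\<lbrakk>a \<in> carrier Q; b \<in> carrier Q\<rbrakk> \<Longrightarrow> a \<triangleleft> b \<in> carrier Q"
    and idem: "a \<in> carrier Q \<Longrightarrow> a \<triangleright> a = a"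
    and qop_qinv: "\<lbrakk>a \<in> carrier Q; b \<in> carrier Q\<rbrakk> \<Longrightarrow> (a \<triangleright> b) \<triangleleft> b = a"
    and qinv_qop: "\<lbrakk>a \<in> carrier Q; b \<in> carrier Q\<rbrakk> \<Longrightarrow> (a \<triangleleft> b) \<triangleright> b = a"
    and self_dist: "\<lbrakk>a \<in> carrier Q; b \<in> carrier Q; c \<in> carrier Q\<rbrakk>
      \<Longrightarrow> (a \<triangleright> b) \<triangleright> c = (a \<triangleright> c) \<triangleright> (b \<triangleright> c)"

definition quandle_hom ::
    "('a, 'm) quandle_scheme \<Rightarrow> ('b, 'n) quandle_scheme \<Rightarrow> ('a \<Rightarrow> 'b) set" where
  "quandle_hom Q Q' = {f \<in> carrier Q \<rightarrow> carrier Q'.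
     \<forall>a \<in> carrier Q. \<forall>b \<in> carrier Q. f (a \<triangleright>\<^bsub>Q\<^esub> b) = f a \<triangleright>\<^bsub>Q'\<^esub> f b}"

definition pointed_quandle_hom ::
    "('a, 'm) quandle_scheme \<Rightarrow> 'a \<Rightarrow> ('b, 'n) quandle_scheme \<Rightarrow> 'b \<Rightarrow> ('a \<Rightarrow> 'b) set" where
  "pointed_quandle_hom Q q Q' q' = {f \<in> quandle_hom Q Q'. f q = q'}"

locale pointed_quandle = quandle Q for Q :: "('a, 'm) quandle_scheme" (structure) +
  fixes q :: 'a
  assumes base_closed: "q \<in> carrier Q"

text \<open>As in \<^const>\<open>BijGroup\<close>, automorphisms are taken extensional on the carrier.\<close>

definition AutQ :: "('a, 'm) quandle_scheme \<Rightarrow> ('a \<Rightarrow> 'a) monoid" where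
  "AutQ Q = (BijGroup (carrier Q)) \<lparr>carrier := Bij (carrier Q) \<inter> quandle_hom Q Q\<rparr>"

definition right_translation :: "('a, 'm) quandle_scheme \<Rightarrow> 'a \<Rightarrow> 'a \<Rightarrow> 'a" where
  "right_translation Q a = (\<lambda>x \<in> carrier Q. x \<triangleright>\<^bsub>Q\<^esub> a)"

definition Inn :: "('a, 'm) quandle_scheme \<Rightarrow> ('a \<Rightarrow> 'a) monoid" where
  "Inn Q = (AutQ Q) \<lparr>carrier := generate (AutQ Q) (right_translation Q ` carrier Q)\<rparr>"

locale connected_quandle = quandle +
  assumes inn_transitive: "transitive_action (Inn Q) (carrier Q) (\<lambda>\<phi>. \<phi>)"

locale quandle_covering =
  source: quandle Qt + target: quandle Q
  for Qt :: "('b, 'n) quandle_scheme" and Q :: "('a, 'm) quandle_scheme" +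
  fixes p :: "'b \<Rightarrow> 'a"
  assumes hom: "p \<in> quandle_hom Qt Q"
    and surj: "p ` carrier Qt = carrier Q"
    and covering: "\<lbrakk>x \<in> carrier Qt; y \<in> carrier Qt; z \<in> carrier Qt; p y = p z\<rbrakk>
      \<Longrightarrow> x \<triangleright>\<^bsub>Qt\<^esub> y = x \<triangleright>\<^bsub>Qt\<^esub> z"


section \<open>Groups presented by generators and relations\<close>

text \<open>A word is a list of letters \<open>(s, a)\<close>, where \<open>(True, a)\<close> stands for the generator \<open>a\<close>
  and \<open>(False, a)\<close> for its formal inverse. A relator is a pair of words to be identified.\<close>

type_synonym 'a word = "(bool \<times> 'a) list"

definition words :: "'a set \<Rightarrow> 'a word set" where
  "words S = lists (UNIV \<times> S)"

inductive pres_eq :: "'a set \<Rightarrow> ('a word \<times> 'a word) set \<Rightarrow> 'a word \<Rightarrow> 'a word \<Rightarrow> bool"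
  for S R where
  refl: "w \<in> words S \<Longrightarrow> pres_eq S R w w"
| sym: "pres_eq S R v w \<Longrightarrow> pres_eq S R w v"
| trans: "\<lbrakk>pres_eq S R u v; pres_eq S R v w\<rbrakk> \<Longrightarrow> pres_eq S R u w"
| cancel: "\<lbrakk>u \<in> words S; v \<in> words S; a \<in> S\<rbrakk>
    \<Longrightarrow> pres_eq S R (u @ [(s, a), (\<not> s, a)] @ v) (u @ v)"
| rel: "\<lbrakk>u \<in> words S; v \<in> words S; l \<in> words S; r \<in> words S; (l, r) \<in> R\<rbrakk>
    \<Longrightarrow> pres_eq S R (u @ l @ v) (u @ r @ v)"

definition pres_rel :: "'a set \<Rightarrow> ('a word \<times> 'a word) set \<Rightarrow> 'a word rel" where
  "pres_rel S R = {(v, w). pres_eq S R v w}"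

definition pres_class :: "'a set \<Rightarrow> ('a word \<times> 'a word) set \<Rightarrow> 'a word \<Rightarrow> 'a word set" where
  "pres_class S R w = pres_rel S R `` {w}"

definition pres_group ::
    "'a set \<Rightarrow> ('a word \<times> 'a word) set \<Rightarrow> 'a word set monoid" where
  "pres_group S R =
    \<lparr>carrier = words S // pres_rel S R,
     monoid.mult = \<lambda>A B. \<Union>u \<in> A. \<Union>v \<in> B. pres_class S R (u @ v),
     one = pres_class S R []\<rparr>"

primrec word_eval :: "('g, 'm) monoid_scheme \<Rightarrow> ('a \<Rightarrow> 'g) \<Rightarrow> 'a word \<Rightarrow> 'g" where
  "word_eval G \<phi> [] = \<one>\<^bsub>G\<^esub>"
| "word_eval G \<phi> (c # w) =
    (if fst c then \<phi> (snd c) else inv\<^bsub>G\<^esub> \<phi> (snd c)) \<otimes>\<^bsub>G\<^esub> word_eval G \<phi> w"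

text \<open>The homomorphism into \<open>G\<close> extending an assignment \<open>\<phi>\<close> of the generators. It is meaningful
  only if \<open>\<phi>\<close> respects the relators, so that \<^const>\<open>word_eval\<close> is constant on classes; see
  \<open>pres_lift_class\<close> and \<open>pres_lift_hom\<close> below.\<close>

definition pres_lift :: "('g, 'm) monoid_scheme \<Rightarrow> ('a \<Rightarrow> 'g) \<Rightarrow> 'a word set \<Rightarrow> 'g" where
  "pres_lift G \<phi> A = the_elem (word_eval G \<phi> ` A)"

lemma words_simps [simp]:
  "[] \<in> words S"
  "c # w \<in> words S \<longleftrightarrow> snd c \<in> S \<and> w \<in> words S"
  "v @ w \<in> words S \<longleftrightarrow> v \<in> words S \<and> w \<in> words S"
  by (cases c; auto simp: words_def)+

lemma pres_eq_words: "pres_eq S R v w \<Longrightarrow> v \<in> words S \<and> w \<in> words S"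
  by (induction rule: pres_eq.induct) auto

lemma equiv_pres_rel: "equiv (words S) (pres_rel S R)"
proof (rule equivI)
  show "pres_rel S R \<subseteq> words S \<times> words S"
    by (auto simp: pres_rel_def dest: pres_eq_words)
  show "refl_on (words S) (pres_rel S R)"
    by (auto simp: pres_rel_def refl_on_def intro: pres_eq.refl)
  show "sym (pres_rel S R)"
    unfolding pres_rel_def sym_def by (blast intro: pres_eq.sym)
  show "trans (pres_rel S R)"
    unfolding pres_rel_def trans_def by (blast intro: pres_eq.trans)
qed

lemma pres_eq_append_left: "pres_eq S R v w \<Longrightarrow> u \<in> words S \<Longrightarrow> pres_eq S R (u @ v) (u @ w)"
proof (induction rule: pres_eq.induct)
  case (cancel u' v a s)
  then show ?case using pres_eq.cancel[of "u @ u'" S v a R s] by simp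
next
  case (rel u' v l r)
  then show ?case using pres_eq.rel[of "u @ u'" S v l r R] by simp
next
  case (trans v1 v2 v3)
  then show ?case by (blast intro: pres_eq.trans)
qed (simp_all add: pres_eq.refl pres_eq.sym)

lemma pres_eq_append_right: "pres_eq S R v w \<Longrightarrow> u \<in> words S \<Longrightarrow> pres_eq S R (v @ u) (w @ u)"
proof (induction rule: pres_eq.induct)
  case (cancel u' v a s)
  then show ?case using pres_eq.cancel[of u' S "v @ u" a R s] by simp
next
  case (rel u' v l r)
  then show ?case using pres_eq.rel[of u' S "v @ u" l r R] by simp
next
  case (trans v1 v2 v3)
  then show ?case by (blast intro: pres_eq.trans)
qed (simp_all add: pres_eq.refl pres_eq.sym)

lemma pres_eq_append:
  "pres_eq S R u v \<Longrightarrow> pres_eq S R u' v' \<Longrightarrow> pres_eq S R (u @ u') (v @ v')"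
  by (meson pres_eq.trans pres_eq_append_left pres_eq_append_right pres_eq_words)

lemma pres_class_eq_iff:
  "v \<in> words S \<Longrightarrow> w \<in> words S \<Longrightarrow> pres_class S R v = pres_class S R w \<longleftrightarrow> pres_eq S R v w"
  using eq_equiv_class_iff[OF equiv_pres_rel, of v S w R] by (simp add: pres_class_def pres_rel_def)

lemma mem_pres_class: "v \<in> pres_class S R w \<longleftrightarrow> pres_eq S R w v"
  by (simp add: pres_class_def pres_rel_def)

lemma carrier_pres_group: "carrier (pres_group S R) = pres_class S R ` words S"
  by (auto simp: pres_group_def quotient_def pres_class_def)

lemma one_pres_group: "\<one>\<^bsub>pres_group S R\<^esub> = pres_class S R []"
  by (simp add: pres_group_def)

lemma mult_pres_group:
  assumes "v \<in> words S" "w \<in> words S"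
  shows "pres_class S R v \<otimes>\<^bsub>pres_group S R\<^esub> pres_class S R w = pres_class S R (v @ w)"
proof -
  have "pres_class S R (v' @ w') = pres_class S R (v @ w)"
    if "v' \<in> pres_class S R v" "w' \<in> pres_class S R w" for v' w'
  proof -
    have "pres_eq S R (v' @ w') (v @ w)"
      using that by (simp add: mem_pres_class pres_eq_append pres_eq.sym)
    then show ?thesis using pres_eq_words pres_class_eq_iff by blast
  qed
  moreover have "v \<in> pres_class S R v" "w \<in> pres_class S R w"
    using assms by (simp_all add: mem_pres_class pres_eq.refl)
  ultimately have "(\<Union>v' \<in> pres_class S R v. \<Union>w' \<in> pres_class S R w. pres_class S R (v' @ w')) =
      pres_class S R (v @ w)" by blast
  then show ?thesis by (simp add: pres_group_def)
qed

definition word_inv :: "'a word \<Rightarrow> 'a word" where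
  "word_inv w = rev (map (\<lambda>(s, a). (\<not> s, a)) w)"

lemma word_inv_words: "w \<in> words S \<Longrightarrow> word_inv w \<in> words S"
  by (induction w) (auto simp: word_inv_def)

lemma word_inv_cancel: "w \<in> words S \<Longrightarrow> pres_eq S R (word_inv w @ w) []"
proof (induction w)
  case Nil
  then show ?case by (simp add: word_inv_def pres_eq.refl)
next
  case (Cons c w)
  obtain s a where c: "c = (s, a)" by fastforce
  have "pres_eq S R (word_inv w @ [(\<not> s, a), (\<not> \<not> s, a)] @ w) (word_inv w @ w)"
    using Cons.prems c by (intro pres_eq.cancel) (auto intro: word_inv_words)
  moreover have "pres_eq S R (word_inv w @ w) []"
    using Cons by simp
  ultimately have "pres_eq S R (word_inv w @ [(\<not> s, a), (\<not> \<not> s, a)] @ w) []"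
    by (rule pres_eq.trans)
  then show ?case using c by (simp add: word_inv_def)
qed

lemma group_pres_group: "group (pres_group S R)"
proof (rule groupI)
  fix x assume "x \<in> carrier (pres_group S R)"
  then obtain w where w: "w \<in> words S" "x = pres_class S R w" by (auto simp: carrier_pres_group)
  have "pres_class S R (word_inv w) \<otimes>\<^bsub>pres_group S R\<^esub> x = \<one>\<^bsub>pres_group S R\<^esub>"
    using w by (simp add: mult_pres_group word_inv_words one_pres_group pres_class_eq_iff word_inv_cancel)
  then show "\<exists>y\<in>carrier (pres_group S R). y \<otimes>\<^bsub>pres_group S R\<^esub> x = \<one>\<^bsub>pres_group S R\<^esub>"
    using w by (auto simp: carrier_pres_group intro: word_inv_words)
qed (auto simp: carrier_pres_group mult_pres_group one_pres_group)

locale pres_assignment = group G for G :: "('g, 'm) monoid_scheme" (structure) +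
  fixes S :: "'a set" and R :: "('a word \<times> 'a word) set" and \<phi> :: "'a \<Rightarrow> 'g"
  assumes assign_closed: "a \<in> S \<Longrightarrow> \<phi> a \<in> carrier G"
    and respects: "\<lbrakk>l \<in> words S; r \<in> words S; (l, r) \<in> R\<rbrakk> \<Longrightarrow> word_eval G \<phi> l = word_eval G \<phi> r"
begin

lemma word_eval_closed: "w \<in> words S \<Longrightarrow> word_eval G \<phi> w \<in> carrier G"
  by (induction w) (auto intro: assign_closed)

lemma word_eval_append:
  "v \<in> words S \<Longrightarrow> w \<in> words S \<Longrightarrow> word_eval G \<phi> (v @ w) = word_eval G \<phi> v \<otimes> word_eval G \<phi> w"
  by (induction v) (auto simp: word_eval_closed assign_closed m_assoc)

lemma word_eval_pres_eq: "pres_eq S R v w \<Longrightarrow> word_eval G \<phi> v = word_eval G \<phi> w"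
proof (induction rule: pres_eq.induct)
  case (cancel u v a s)
  have "word_eval G \<phi> [(s, a), (\<not> s, a)] = \<one>"
    using cancel by (simp add: assign_closed)
  then show ?case
    using cancel word_eval_append[of u "[(s, a), (\<not> s, a)] @ v"]
      word_eval_append[of "[(s, a), (\<not> s, a)]" v] word_eval_append[of u v]
    by (simp add: word_eval_closed)
next
  case (rel u v l r)
  then show ?case by (simp add: word_eval_append respects)
qed auto

lemma pres_lift_class: "w \<in> words S \<Longrightarrow> pres_lift G \<phi> (pres_class S R w) = word_eval G \<phi> w"
proof -
  assume w: "w \<in> words S"
  then have "word_eval G \<phi> ` pres_class S R w = {word_eval G \<phi> w}"
    by (intro equalityI subsetI)
      (auto simp: mem_pres_class pres_eq.refl dest: word_eval_pres_eq[symmetric])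
  then show ?thesis by (simp add: pres_lift_def)
qed

lemma pres_lift_hom: "pres_lift G \<phi> \<in> hom (pres_group S R) G"
  by (rule homI)
    (auto simp: carrier_pres_group mult_pres_group pres_lift_class word_eval_closed word_eval_append)

end


section \<open>The adjoint group and the fundamental group\<close>

definition adj_relators :: "('a, 'm) quandle_scheme \<Rightarrow> ('a word \<times> 'a word) set" where
  "adj_relators Q = {([(True, a \<triangleright>\<^bsub>Q\<^esub> b)], [(False, b), (True, a), (True, b)]) | a b.
     a \<in> carrier Q \<and> b \<in> carrier Q}"

definition Adj :: "('a, 'm) quandle_scheme \<Rightarrow> 'a word set monoid" where
  "Adj Q = pres_group (carrier Q) (adj_relators Q)"

definition adj :: "('a, 'm) quandle_scheme \<Rightarrow> 'a \<Rightarrow> 'a word set" where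
  "adj Q a = pres_class (carrier Q) (adj_relators Q) [(True, a)]"

definition Adj_map :: "('b, 'n) quandle_scheme \<Rightarrow> ('a \<Rightarrow> 'b) \<Rightarrow> 'a word set \<Rightarrow> 'b word set" where
  "Adj_map Q' f = pres_lift (Adj Q') (\<lambda>a. adj Q' (f a))"

definition Adj_eps :: "'a word set \<Rightarrow> int" where
  "Adj_eps = pres_lift integer_group (\<lambda>_. 1)"

definition Adj0 :: "('a, 'm) quandle_scheme \<Rightarrow> 'a word set set" where
  "Adj0 Q = kernel (Adj Q) integer_group Adj_eps"

text \<open>The right action of \<open>Adj Q\<close> on \<open>Q\<close>: letters of a word act from left to right. The action
  is constant on classes by \<open>word_act_pres_eq\<close> below.\<close>

primrec word_act :: "('a, 'm) quandle_scheme \<Rightarrow> 'a \<Rightarrow> 'a word \<Rightarrow> 'a" where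
  "word_act Q x [] = x"
| "word_act Q x (c # w) =
    word_act Q (if fst c then x \<triangleright>\<^bsub>Q\<^esub> snd c else x \<triangleleft>\<^bsub>Q\<^esub> snd c) w"

definition Adj_act :: "('a, 'm) quandle_scheme \<Rightarrow> 'a \<Rightarrow> 'a word set \<Rightarrow> 'a" where
  "Adj_act Q x g = the_elem (word_act Q x ` g)"

definition pi1 :: "('a, 'm) quandle_scheme \<Rightarrow> 'a \<Rightarrow> 'a word set set" where
  "pi1 Q q = {g \<in> Adj0 Q. Adj_act Q q g = q}"

definition pi1_map :: "('a, 'm) quandle_scheme \<Rightarrow> 'a \<Rightarrow> ('b, 'n) quandle_scheme
    \<Rightarrow> ('a \<Rightarrow> 'b) \<Rightarrow> 'a word set \<Rightarrow> 'b word set" where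
  "pi1_map Q q Q' f = restrict (Adj_map Q' f) (pi1 Q q)"

definition is_lifting :: "('c, 'k) quandle_scheme \<Rightarrow> 'c \<Rightarrow> ('b, 'n) quandle_scheme \<Rightarrow> 'b
    \<Rightarrow> ('b \<Rightarrow> 'a) \<Rightarrow> ('c \<Rightarrow> 'a) \<Rightarrow> ('c \<Rightarrow> 'b) \<Rightarrow> bool" where
  "is_lifting X x Qt qt p f ft \<longleftrightarrow>
     ft \<in> pointed_quandle_hom X x Qt qt \<and> (\<forall>y \<in> carrier X. p (ft y) = f y)"


subsection \<open>Well-definedness\<close>

lemma group_Adj: "group (Adj Q)"
  by (simp add: Adj_def group_pres_group)

lemma adj_closed: "a \<in> carrier Q \<Longrightarrow> adj Q a \<in> carrier (Adj Q)"
  by (simp add: Adj_def adj_def carrier_pres_group)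

lemma inv_adj:
  assumes "a \<in> carrier Q"
  shows "inv\<^bsub>Adj Q\<^esub> adj Q a = pres_class (carrier Q) (adj_relators Q) [(False, a)]"
proof -
  let ?g = "pres_class (carrier Q) (adj_relators Q) [(False, a)]"
  have "?g \<otimes>\<^bsub>Adj Q\<^esub> adj Q a = \<one>\<^bsub>Adj Q\<^esub>"
    using assms pres_eq.cancel[of "[]" "carrier Q" "[]" a "adj_relators Q" False]
    by (simp add: Adj_def adj_def mult_pres_group one_pres_group pres_class_eq_iff)
  moreover have "?g \<in> carrier (Adj Q)"
    using assms by (simp add: Adj_def carrier_pres_group)
  ultimately show ?thesis
    using group.inv_equality[OF group_Adj] adj_closed[OF assms] by metis
qed

lemma pres_assignment_eps: "pres_assignment integer_group (carrier Q) (adj_relators Q) (\<lambda>_. 1)"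
proof -
  have "group integer_group" by simp
  moreover have "inv\<^bsub>integer_group\<^esub> (1::int) = - 1"
    by (rule group.inv_equality) auto
  ultimately show ?thesis
    by (auto simp: pres_assignment_def pres_assignment_axioms_def adj_relators_def)
qed

lemma Adj_eps_hom: "Adj_eps \<in> hom (Adj Q) integer_group"
  unfolding Adj_eps_def Adj_def by (rule pres_assignment.pres_lift_hom[OF pres_assignment_eps])

lemma Adj_eps_adj: "a \<in> carrier Q \<Longrightarrow> Adj_eps (adj Q a) = 1"
  unfolding Adj_eps_def adj_def
  by (subst pres_assignment.pres_lift_class[OF pres_assignment_eps]) auto

context quandle
begin

lemma adj_qop:
  assumes "a \<in> carrier Q" "b \<in> carrier Q"
  shows "adj Q (a \<triangleright> b) = inv\<^bsub>Adj Q\<^esub> adj Q b \<otimes>\<^bsub>Adj Q\<^esub> adj Q a \<otimes>\<^bsub>Adj Q\<^esub> adj Q b"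
proof -
  have "([(True, a \<triangleright> b)], [(False, b), (True, a), (True, b)]) \<in> adj_relators Q"
    using assms by (auto simp: adj_relators_def)
  then have "pres_eq (carrier Q) (adj_relators Q) [(True, a \<triangleright> b)] [(False, b), (True, a), (True, b)]"
    using assms pres_eq.rel[of "[]" "carrier Q" "[]" "[(True, a \<triangleright> b)]"
        "[(False, b), (True, a), (True, b)]" "adj_relators Q"] by simp
  then show ?thesis
    using assms by (simp add: inv_adj) (simp add: adj_def Adj_def mult_pres_group pres_class_eq_iff)
qed

lemma qinv_unique: "\<lbrakk>x \<in> carrier Q; y \<in> carrier Q; a \<in> carrier Q; x \<triangleright> a = y\<rbrakk> \<Longrightarrow> x = y \<triangleleft> a"
  using qop_qinv[of x a] by simp

lemma word_act_closed: "x \<in> carrier Q \<Longrightarrow> w \<in> words (carrier Q) \<Longrightarrow> word_act Q x w \<in> carrier Q"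
  by (induction w arbitrary: x) auto

lemma word_act_append: "word_act Q x (v @ w) = word_act Q (word_act Q x v) w"
  by (induction v arbitrary: x) auto

lemma word_act_qop:
  "\<lbrakk>x \<in> carrier Q; y \<in> carrier Q; w \<in> words (carrier Q)\<rbrakk>
    \<Longrightarrow> word_act Q (x \<triangleright> y) w = word_act Q x w \<triangleright> word_act Q y w"
proof (induction w arbitrary: x y)
  case (Cons c w)
  have "(x \<triangleright> y) \<triangleleft> snd c = (x \<triangleleft> snd c) \<triangleright> (y \<triangleleft> snd c)"
    using Cons.prems self_dist[of "x \<triangleleft> snd c" "y \<triangleleft> snd c" "snd c"]
    by (intro qinv_unique[symmetric]) (auto simp: qinv_qop)
  with Cons self_dist[of x y "snd c"] show ?case by simp
qed simp

lemma word_act_pres_eq: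
  "pres_eq (carrier Q) (adj_relators Q) v w \<Longrightarrow> x \<in> carrier Q \<Longrightarrow> word_act Q x v = word_act Q x w"
proof (induction arbitrary: x rule: pres_eq.induct)
  case (cancel u v a s)
  then have "word_act Q x u \<in> carrier Q" by (simp add: word_act_closed)
  with cancel show ?case by (cases s) (simp_all add: word_act_append qop_qinv qinv_qop)
next
  case (rel u v l r)
  then have x: "word_act Q x u \<in> carrier Q" by (simp add: word_act_closed)
  obtain a b where ab: "a \<in> carrier Q" "b \<in> carrier Q"
    "l = [(True, a \<triangleright> b)]" "r = [(False, b), (True, a), (True, b)]"
    using rel by (auto simp: adj_relators_def)
  have "((y \<triangleleft> b) \<triangleright> a) \<triangleright> b = y \<triangleright> (a \<triangleright> b)" if "y \<in> carrier Q" for y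
    using that ab self_dist[of "y \<triangleleft> b" a b] by (simp add: qinv_qop)
  with x ab show ?case by (simp add: word_act_append)
qed auto

lemma Adj_act_class:
  assumes "x \<in> carrier Q" "w \<in> words (carrier Q)"
  shows "Adj_act Q x (pres_class (carrier Q) (adj_relators Q) w) = word_act Q x w"
proof -
  have "word_act Q x ` pres_class (carrier Q) (adj_relators Q) w = {word_act Q x w}"
    using assms
    by (intro equalityI subsetI)
      (auto simp: mem_pres_class pres_eq.refl dest: word_act_pres_eq[symmetric])
  then show ?thesis by (simp add: Adj_act_def)
qed

lemma Adj_act_adj: "\<lbrakk>a \<in> carrier Q; b \<in> carrier Q\<rbrakk> \<Longrightarrow> Adj_act Q a (adj Q b) = a \<triangleright> b"
  by (simp add: adj_def Adj_act_class)

lemma Adj_act_closed: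
  "\<lbrakk>x \<in> carrier Q; g \<in> carrier (Adj Q)\<rbrakk> \<Longrightarrow> Adj_act Q x g \<in> carrier Q"
  by (auto simp: Adj_def carrier_pres_group Adj_act_class word_act_closed)

lemma Adj_act_one: "x \<in> carrier Q \<Longrightarrow> Adj_act Q x \<one>\<^bsub>Adj Q\<^esub> = x"
  by (simp add: Adj_def one_pres_group Adj_act_class)

lemma Adj_act_mult:
  "\<lbrakk>x \<in> carrier Q; g \<in> carrier (Adj Q); h \<in> carrier (Adj Q)\<rbrakk>
    \<Longrightarrow> Adj_act Q x (g \<otimes>\<^bsub>Adj Q\<^esub> h) = Adj_act Q (Adj_act Q x g) h"
  by (auto simp: Adj_def carrier_pres_group mult_pres_group Adj_act_class word_act_closed
      word_act_append)

lemma Adj_act_qop: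
  "\<lbrakk>x \<in> carrier Q; y \<in> carrier Q; g \<in> carrier (Adj Q)\<rbrakk>
    \<Longrightarrow> Adj_act Q (x \<triangleright> y) g = Adj_act Q x g \<triangleright> Adj_act Q y g"
  by (auto simp: Adj_def carrier_pres_group Adj_act_class word_act_qop)

lemma pres_assignment_Adj_map:
  assumes "quandle Q'" "f \<in> quandle_hom Q Q'"
  shows "pres_assignment (Adj Q') (carrier Q) (adj_relators Q) (\<lambda>a. adj Q' (f a))"
proof -
  interpret Q': quandle Q' by fact
  interpret A': group "Adj Q'" by (rule group_Adj)
  have f: "f a \<in> carrier Q'" "a \<in> carrier Q \<Longrightarrow> b \<in> carrier Q \<Longrightarrow> f (a \<triangleright> b) = f a \<triangleright>\<^bsub>Q'\<^esub> f b"
    if "a \<in> carrier Q" for a b using assms(2) that by (auto simp: quandle_hom_def)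
  show ?thesis
    by unfold_locales
      (auto simp: f adj_closed adj_relators_def Q'.adj_qop A'.m_assoc)
qed

lemma Adj_map_hom:
  "\<lbrakk>quandle Q'; f \<in> quandle_hom Q Q'\<rbrakk> \<Longrightarrow> Adj_map Q' f \<in> hom (Adj Q) (Adj Q')"
  unfolding Adj_map_def Adj_def[of Q]
  by (rule pres_assignment.pres_lift_hom[OF pres_assignment_Adj_map])

lemma Adj_map_adj:
  assumes "quandle Q'" "f \<in> quandle_hom Q Q'" "a \<in> carrier Q"
  shows "Adj_map Q' f (adj Q a) = adj Q' (f a)"
proof -
  interpret pres_assignment "Adj Q'" "carrier Q" "adj_relators Q" "\<lambda>a. adj Q' (f a)"
    using assms by (intro pres_assignment_Adj_map)
  show ?thesis
    unfolding Adj_map_def adj_def[of Q] using assms(3) assign_closed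
    by (subst pres_lift_class) auto
qed

lemma right_translation_AutQ:
  assumes a: "a \<in> carrier Q" shows "right_translation Q a \<in> carrier (AutQ Q)"
proof -
  have "bij_betw (\<lambda>x. x \<triangleright> a) (carrier Q) (carrier Q)"
    by (rule bij_betw_byWitness[where f' = "\<lambda>x. x \<triangleleft> a"]) (use a in \<open>auto simp: qop_qinv qinv_qop\<close>)
  then have "right_translation Q a \<in> Bij (carrier Q)"
    by (auto simp: right_translation_def Bij_def)
  with a show ?thesis
    by (auto simp: AutQ_def quandle_hom_def right_translation_def intro: self_dist)
qed

lemma subgroup_AutQ: "subgroup (Bij (carrier Q) \<inter> quandle_hom Q Q) (BijGroup (carrier Q))"
proof -
  interpret B: group "BijGroup (carrier Q)" by (rule group_BijGroup)
  show ?thesis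
  proof (rule B.subgroupI)
    show "Bij (carrier Q) \<inter> quandle_hom Q Q \<subseteq> carrier (BijGroup (carrier Q))"
      by (auto simp: BijGroup_def)
    have "(\<lambda>x\<in>carrier Q. x) \<in> Bij (carrier Q) \<inter> quandle_hom Q Q"
      using id_Bij by (auto simp: quandle_hom_def)
    then show "Bij (carrier Q) \<inter> quandle_hom Q Q \<noteq> {}" by blast
  next
    fix \<phi> assume \<phi>: "\<phi> \<in> Bij (carrier Q) \<inter> quandle_hom Q Q"
    let ?\<psi> = "inv_into (carrier Q) \<phi>"
    have bij: "bij_betw \<phi> (carrier Q) (carrier Q)" using \<phi> by (auto simp: Bij_def)
    have \<psi>: "?\<psi> x \<in> carrier Q" "\<phi> (?\<psi> x) = x" if "x \<in> carrier Q" for x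
      using that bij by (auto simp: bij_betw_def inv_into_into f_inv_into_f)
    have "?\<psi> (x \<triangleright> y) = ?\<psi> x \<triangleright> ?\<psi> y" if "x \<in> carrier Q" "y \<in> carrier Q" for x y
    proof (rule inv_into_f_eq)
      show "inj_on \<phi> (carrier Q)" using bij by (simp add: bij_betw_def)
      show "\<phi> (?\<psi> x \<triangleright> ?\<psi> y) = x \<triangleright> y"
        using \<phi> \<psi> that by (simp add: quandle_hom_def)
    qed (use \<psi> that in auto)
    then show "inv\<^bsub>BijGroup (carrier Q)\<^esub> \<phi> \<in> Bij (carrier Q) \<inter> quandle_hom Q Q"
      using \<phi> \<psi> by (auto simp: inv_BijGroup restrict_inv_into_Bij quandle_hom_def)
  next
    fix \<phi> \<psi>
    assume "\<phi> \<in> Bij (carrier Q) \<inter> quandle_hom Q Q" "\<psi> \<in> Bij (carrier Q) \<inter> quandle_hom Q Q"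
    then show "\<phi> \<otimes>\<^bsub>BijGroup (carrier Q)\<^esub> \<psi> \<in> Bij (carrier Q) \<inter> quandle_hom Q Q"
      using compose_Bij[of \<phi> "carrier Q" \<psi>]
      by (auto simp: BijGroup_def quandle_hom_def compose_def Pi_iff)
  qed
qed

lemma group_AutQ: "group (AutQ Q)"
  unfolding AutQ_def
  by (rule subgroup.subgroup_is_group[OF subgroup_AutQ group_BijGroup])

lemma group_action_Inn: "group_action (Inn Q) (carrier Q) (\<lambda>\<phi>. \<phi>)"
proof -
  interpret A: group "AutQ Q" by (rule group_AutQ)
  have sub: "subgroup (carrier (Inn Q)) (AutQ Q)"
    by (auto simp: Inn_def intro!: A.generate_is_subgroup right_translation_AutQ)
  have "group (Inn Q)"
    using subgroup.subgroup_is_group[OF sub A.group_axioms] by (simp add: Inn_def)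
  moreover have "carrier (Inn Q) \<subseteq> Bij (carrier Q)"
    using subgroup.subset[OF sub] by (auto simp: AutQ_def)
  then have "(\<lambda>\<phi>. \<phi>) \<in> hom (Inn Q) (BijGroup (carrier Q))"
    by (auto simp: hom_def Inn_def AutQ_def BijGroup_def)
  ultimately show ?thesis
    by (auto simp: group_action_def group_hom_def group_hom_axioms_def group_BijGroup)
qed

end

end

theory Submission
  imports Defs
begin

text \<open>The proof follows the lifting criterion for covering spaces, with words in the generators of
  the adjoint group in place of paths.

  Let \<open>p : Qt \<rightarrow> Q\<close> be a covering. Right translation of \<open>Qt\<close> by \<open>y\<close> depends only on \<open>p y\<close>, so a letter
  of \<open>Q\<close> acts on \<open>Qt\<close> through an arbitrary preimage. The relators \<open>a * b = b\<inverse> a b\<close> are respected,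
  because a product of preimages of \<open>a\<close> and \<open>b\<close> is a preimage of \<open>a * b\<close>. Hence the adjoint group
  of \<open>Q\<close> acts on \<open>Qt\<close> (\<open>monodromy_pres_eq\<close>), and \<open>p\<close> is equivariant. The subgroup
  \<open>p\<^sub>* \<pi>\<^sub>1(Qt, qt)\<close> is the stabiliser of \<open>qt\<close> in the degree-zero part of this group
  (\<open>pres_class_mem_pi1_image\<close>).

  A lifting \<open>ft\<close> of \<open>f\<close> must carry \<open>x\<close> moved along \<open>w\<close> to \<open>qt\<close> moved along \<open>f w\<close>
  (\<open>lifting_eq_monodromy\<close>). As \<open>X\<close> is connected, every element of \<open>X\<close> is \<open>x\<close> moved along some \<open>w\<close>,
  and therefore \<open>ft\<close> is unique. Moreover \<open>w\<close> can be given degree zero by prepending letters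
  \<open>x\<^sup>\<plusminus>\<^sup>1\<close>, which fix \<open>x\<close> by idempotence. Two degree-zero words with the same endpoint differ by an
  element of \<open>\<pi>\<^sub>1(X, x)\<close>, so the formula defines a map exactly when \<open>f\<^sub>* \<pi>\<^sub>1(X, x)\<close> fixes \<open>qt\<close>. That
  this map is a homomorphism is seen by moving \<open>x\<close> to \<open>y * z\<close> along \<open>x\<inverse> w z\<close>, where \<open>w\<close> moves \<open>x\<close> to
  \<open>y\<close>: the first letter fixes both \<open>x\<close> and \<open>qt\<close>, and the last acts on \<open>Qt\<close> as translation by any
  preimage of \<open>f z\<close>, in particular by the image of \<open>z\<close>.\<close>

section \<open>Words, their degree and their images under maps\<close>

abbreviation adj_class :: "('a, 'm) quandle_scheme \<Rightarrow> 'a word \<Rightarrow> 'a word set" where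
  "adj_class Q \<equiv> pres_class (carrier Q) (adj_relators Q)"

definition word_map :: "('a \<Rightarrow> 'b) \<Rightarrow> 'a word \<Rightarrow> 'b word" where
  "word_map h = map (map_prod id h)"

lemma word_map_simps [simp]:
  "word_map h [] = []"
  "word_map h (c # w) = (fst c, h (snd c)) # word_map h w"
  "word_map h (v @ w) = word_map h v @ word_map h w"
  by (simp_all add: word_map_def map_prod_def split_beta)

lemma word_map_words: "h \<in> S \<rightarrow> T \<Longrightarrow> w \<in> words S \<Longrightarrow> word_map h w \<in> words T"
  by (induction w) auto

lemma word_map_comp: "word_map g (word_map h w) = word_map (g \<circ> h) w"
  by (simp add: word_map_def map_prod.comp)

lemma word_map_cong:
  "w \<in> words S \<Longrightarrow> (\<And>a. a \<in> S \<Longrightarrow> g a = h a) \<Longrightarrow> word_map g w = word_map h w"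
  by (induction w) auto

lemma word_map_word_inv: "word_map h (word_inv w) = word_inv (word_map h w)"
  by (simp add: word_map_def word_inv_def rev_map split_beta)

lemma word_inv_word_inv: "word_inv (word_inv w) = w"
  by (simp add: word_inv_def rev_map[symmetric] comp_def split_beta)

definition exponent_sum :: "'a word \<Rightarrow> int" where
  "exponent_sum w = (\<Sum>c\<leftarrow>w. if fst c then 1 else - 1)"

lemma exponent_sum_simps [simp]:
  "exponent_sum [] = 0"
  "exponent_sum (c # w) = (if fst c then 1 else - 1) + exponent_sum w"
  "exponent_sum (v @ w) = exponent_sum v + exponent_sum w"
  by (simp_all add: exponent_sum_def)

lemma exponent_sum_word_map [simp]: "exponent_sum (word_map h w) = exponent_sum w"
  by (induction w) auto

lemma exponent_sum_word_inv [simp]: "exponent_sum (word_inv w) = - exponent_sum w"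
  by (induction w) (auto simp: word_inv_def split_beta)

lemma Adj_eps_class:
  assumes "w \<in> words (carrier Q)"
  shows "Adj_eps (adj_class Q w) = exponent_sum w"
proof -
  have inv: "inv\<^bsub>integer_group\<^esub> (1::int) = - 1"
    by (rule group.inv_equality) auto
  have "word_eval integer_group (\<lambda>_. 1) w = exponent_sum w"
    by (induction w) (auto simp: inv)
  with assms show ?thesis
    unfolding Adj_eps_def by (subst pres_assignment.pres_lift_class[OF pres_assignment_eps])
qed

lemma mem_Adj0_class:
  assumes "w \<in> words (carrier Q)"
  shows "adj_class Q w \<in> Adj0 Q \<longleftrightarrow> exponent_sum w = 0"
  using assms by (auto simp: Adj0_def kernel_def Adj_def carrier_pres_group Adj_eps_class)

lemma pi1_elem_word:
  assumes "g \<in> pi1 Q q"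
  obtains w where "w \<in> words (carrier Q)" "g = adj_class Q w"
  using assms by (auto simp: pi1_def Adj0_def kernel_def Adj_def carrier_pres_group)

section \<open>The action of words on a quandle\<close>

lemma quandle_hom_closed: "h \<in> quandle_hom Q Q' \<Longrightarrow> a \<in> carrier Q \<Longrightarrow> h a \<in> carrier Q'"
  by (auto simp: quandle_hom_def)

lemma quandle_hom_qop:
  "h \<in> quandle_hom Q Q' \<Longrightarrow> a \<in> carrier Q \<Longrightarrow> b \<in> carrier Q
    \<Longrightarrow> h (a \<triangleright>\<^bsub>Q\<^esub> b) = h a \<triangleright>\<^bsub>Q'\<^esub> h b"
  by (auto simp: quandle_hom_def)

lemma quandle_hom_qinv:
  assumes "quandle Q" "quandle Q'" "h \<in> quandle_hom Q Q'" "a \<in> carrier Q" "b \<in> carrier Q"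
  shows "h (a \<triangleleft>\<^bsub>Q\<^esub> b) = h a \<triangleleft>\<^bsub>Q'\<^esub> h b"
proof (rule quandle.qinv_unique[OF assms(2)])
  show "h (a \<triangleleft>\<^bsub>Q\<^esub> b) \<triangleright>\<^bsub>Q'\<^esub> h b = h a"
    using assms by (simp flip: quandle_hom_qop add: quandle.qinv_closed quandle.qinv_qop)
qed (use assms in \<open>auto intro: quandle_hom_closed quandle.qinv_closed\<close>)

lemma word_act_hom:
  assumes "quandle Q" "quandle Q'" "h \<in> quandle_hom Q Q'"
  shows "a \<in> carrier Q \<Longrightarrow> w \<in> words (carrier Q)
    \<Longrightarrow> h (word_act Q a w) = word_act Q' (h a) (word_map h w)"
proof (induction w arbitrary: a)
  case (Cons c w)
  with assms show ?case
    by (simp add: quandle_hom_qop quandle_hom_qinv quandle.qop_closed quandle.qinv_closed)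
qed simp

lemma Adj_map_class:
  assumes "quandle Q" "quandle Q'" "h \<in> quandle_hom Q Q'" "w \<in> words (carrier Q)"
  shows "Adj_map Q' h (adj_class Q w) = adj_class Q' (word_map h w)"
proof -
  have h: "h \<in> carrier Q \<rightarrow> carrier Q'" using assms(3) by (auto simp: quandle_hom_def)
  have "word_eval (Adj Q') (\<lambda>a. adj Q' (h a)) w = adj_class Q' (word_map h w)"
    using assms(4)
  proof (induction w)
    case Nil
    then show ?case by (simp add: Adj_def one_pres_group)
  next
    case (Cons c w)
    then have c: "h (snd c) \<in> carrier Q'" and w: "word_map h w \<in> words (carrier Q')"
      using h by (auto intro: word_map_words)
    with Cons show ?case
      by (auto simp: inv_adj) (auto simp: adj_def Adj_def mult_pres_group)
  qed
  with assms show ?thesis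
    unfolding Adj_map_def
    by (subst pres_assignment.pres_lift_class[OF quandle.pres_assignment_Adj_map]) auto
qed

context quandle
begin

lemma qinv_self: "a \<in> carrier Q \<Longrightarrow> a \<triangleleft> a = a"
  using qop_qinv[of a a] by (simp add: idem)

lemma word_act_inv_cancel:
  assumes "a \<in> carrier Q" "w \<in> words (carrier Q)"
  shows "word_act Q (word_act Q a (word_inv w)) w = a"
  using word_act_pres_eq[OF word_inv_cancel[OF assms(2)] assms(1)] by (simp add: word_act_append)

lemma word_act_cancel_inv:
  assumes "a \<in> carrier Q" "w \<in> words (carrier Q)"
  shows "word_act Q (word_act Q a w) (word_inv w) = a"
  using word_act_inv_cancel[of a "word_inv w"] assms by (simp add: word_inv_word_inv word_inv_words)

lemma pi1_class:
  assumes "q \<in> carrier Q" "w \<in> words (carrier Q)"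
  shows "adj_class Q w \<in> pi1 Q q \<longleftrightarrow> exponent_sum w = 0 \<and> word_act Q q w = q"
  using assms by (simp add: pi1_def mem_Adj0_class Adj_act_class)

lemma word_act_replicate_self:
  "a \<in> carrier Q \<Longrightarrow> word_act Q a (replicate n (s, a)) = a"
  by (induction n) (auto simp: idem qinv_self)

lemma Inn_word:
  assumes "\<phi> \<in> carrier (Inn Q)"
  shows "\<exists>w \<in> words (carrier Q). \<forall>z \<in> carrier Q. \<phi> z = word_act Q z w"
proof -
  interpret A: group "AutQ Q" by (rule group_AutQ)
  have sub: "subgroup (generate (AutQ Q) (right_translation Q ` carrier Q)) (AutQ Q)"
    by (auto intro!: A.generate_is_subgroup right_translation_AutQ)
  have mult: "(\<phi> \<otimes>\<^bsub>AutQ Q\<^esub> \<psi>) z = \<phi> (\<psi> z)"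
    if "\<phi> \<in> carrier (AutQ Q)" "\<psi> \<in> carrier (AutQ Q)" "z \<in> carrier Q" for \<phi> \<psi> z
    using that by (auto simp: AutQ_def BijGroup_def compose_def)
  have unit: "\<one>\<^bsub>AutQ Q\<^esub> z = z" if "z \<in> carrier Q" for z
    using that by (simp add: AutQ_def BijGroup_def)
  have maps: "\<phi> z \<in> carrier Q" if "\<phi> \<in> carrier (AutQ Q)" "z \<in> carrier Q" for \<phi> z
    using that by (auto simp: AutQ_def quandle_hom_def)
  from assms have "\<phi> \<in> generate (AutQ Q) (right_translation Q ` carrier Q)"
    by (simp add: Inn_def)
  then show ?thesis
  proof (induction rule: generate.induct)
    case one
    then show ?case by (intro bexI[of _ "[]"]) (auto simp: unit)
  next
    case (incl h)
    then obtain a where "a \<in> carrier Q" "h = right_translation Q a" by auto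
    then show ?case by (intro bexI[of _ "[(True, a)]"]) (auto simp: right_translation_def)
  next
    case (inv h)
    then obtain a where a: "a \<in> carrier Q" "h = right_translation Q a" by auto
    let ?k = "inv\<^bsub>AutQ Q\<^esub> h"
    have h: "h \<in> carrier (AutQ Q)" using a by (simp add: right_translation_AutQ)
    have "?k z = z \<triangleleft> a" if z: "z \<in> carrier Q" for z
    proof (rule qinv_unique)
      show "?k z \<in> carrier Q" using maps[of ?k z] h z by simp
      have "h (?k z) = z" using mult[of h ?k z] h z by (simp add: A.r_inv unit)
      with \<open>?k z \<in> carrier Q\<close> show "?k z \<triangleright> a = z" by (simp add: a right_translation_def)
    qed (use z a in auto)
    then show ?case using a by (intro bexI[of _ "[(False, a)]"]) auto
  next
    case (eng g h)
    then obtain v w where v: "v \<in> words (carrier Q)" "\<And>z. z \<in> carrier Q \<Longrightarrow> g z = word_act Q z v"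
      and w: "w \<in> words (carrier Q)" "\<And>z. z \<in> carrier Q \<Longrightarrow> h z = word_act Q z w" by blast
    from eng have gh: "g \<in> carrier (AutQ Q)" "h \<in> carrier (AutQ Q)"
      using subgroup.subset[OF sub] by auto
    \<comment> \<open>Composition applies \<open>h\<close> first, whereas the letters of a word act from left to right.\<close>
    show ?case
      using v w gh
      by (intro bexI[of _ "w @ v"]) (auto simp: mult word_act_append word_act_closed)
  qed
qed

end

text \<open>Connectedness only provides some word from \<open>a\<close> to \<open>b\<close>. Prepending letters \<open>a\<close> or their
  inverses changes its degree without changing its endpoint, since they fix \<open>a\<close>.\<close>

lemma (in connected_quandle) degree_zero_word:
  assumes a: "a \<in> carrier Q" and b: "b \<in> carrier Q"
  obtains w where "w \<in> words (carrier Q)" "exponent_sum w = 0" "word_act Q a w = b"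
proof -
  interpret transitive_action "Inn Q" "carrier Q" "\<lambda>\<phi>. \<phi>" by (rule inn_transitive)
  obtain \<phi> where "\<phi> \<in> carrier (Inn Q)" "\<phi> a = b"
    using unique_orbit[OF a b] by blast
  with Inn_word[of \<phi>] a obtain v where v: "v \<in> words (carrier Q)" "word_act Q a v = b" by auto
  define u where "u = replicate (nat \<bar>exponent_sum v\<bar>) (exponent_sum v < 0, a)"
  have rep: "exponent_sum (replicate n (s, a)) = (if s then int n else - int n)" for n s
    by (induction n) auto
  have "u \<in> words (carrier Q)"
    using a by (auto simp: u_def words_def)
  moreover have "exponent_sum (u @ v) = 0"
    by (auto simp: u_def rep)
  moreover have "word_act Q a (u @ v) = b"
    using v a by (simp add: u_def word_act_append word_act_replicate_self)
  ultimately show thesis using v by (intro that[of "u @ v"]) auto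
qed

section \<open>Monodromy of a covering\<close>

context quandle_covering
begin

lemma covering_qinv:
  assumes "x \<in> carrier Qt" "y \<in> carrier Qt" "z \<in> carrier Qt" "p y = p z"
  shows "x \<triangleleft>\<^bsub>Qt\<^esub> y = x \<triangleleft>\<^bsub>Qt\<^esub> z"
proof (rule source.qinv_unique)
  show "(x \<triangleleft>\<^bsub>Qt\<^esub> y) \<triangleright>\<^bsub>Qt\<^esub> z = x"
    using assms covering[of "x \<triangleleft>\<^bsub>Qt\<^esub> y" y z] by (simp add: source.qinv_qop)
qed (use assms in auto)

lemma word_act_cong:
  assumes "x \<in> carrier Qt" "v \<in> words (carrier Qt)" "w \<in> words (carrier Qt)"
    and "word_map p v = word_map p w"
  shows "word_act Qt x v = word_act Qt x w"
  using assms
proof (induction v arbitrary: x w)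
  case Nil
  then show ?case by (cases w) auto
next
  case (Cons c v)
  then obtain d u where w: "w = d # u" by (cases w) auto
  with Cons have "x \<triangleright>\<^bsub>Qt\<^esub> snd c = x \<triangleright>\<^bsub>Qt\<^esub> snd d" "x \<triangleleft>\<^bsub>Qt\<^esub> snd c = x \<triangleleft>\<^bsub>Qt\<^esub> snd d"
    by (auto intro: covering covering_qinv)
  with Cons w show ?case by auto
qed

definition lift_word :: "'a word \<Rightarrow> 'b word" where
  "lift_word = word_map (inv_into (carrier Qt) p)"

definition monodromy :: "'b \<Rightarrow> 'a word \<Rightarrow> 'b" where
  "monodromy x w = word_act Qt x (lift_word w)"

lemma lift_word_words: "w \<in> words (carrier Q) \<Longrightarrow> lift_word w \<in> words (carrier Qt)"
  unfolding lift_word_def by (rule word_map_words) (auto simp: surj intro: inv_into_into)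

lemma word_map_lift_word: "w \<in> words (carrier Q) \<Longrightarrow> word_map p (lift_word w) = w"
  by (induction w) (auto simp: lift_word_def f_inv_into_f surj)

lemma word_map_words_p: "w \<in> words (carrier Qt) \<Longrightarrow> word_map p w \<in> words (carrier Q)"
  by (rule word_map_words) (use hom in \<open>auto simp: quandle_hom_def\<close>)

lemma monodromy_closed:
  "x \<in> carrier Qt \<Longrightarrow> w \<in> words (carrier Q) \<Longrightarrow> monodromy x w \<in> carrier Qt"
  by (simp add: monodromy_def source.word_act_closed lift_word_words)

lemma monodromy_append: "monodromy x (v @ w) = monodromy (monodromy x v) w"
  by (simp add: monodromy_def lift_word_def source.word_act_append)

text \<open>The choice of preimages made by \<^const>\<open>lift_word\<close> is immaterial.\<close>

lemma monodromy_word_map: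
  "x \<in> carrier Qt \<Longrightarrow> w \<in> words (carrier Qt) \<Longrightarrow> monodromy x (word_map p w) = word_act Qt x w"
  unfolding monodromy_def
  by (rule word_act_cong) (simp_all add: lift_word_words word_map_lift_word word_map_words_p)

lemma monodromy_qop:
  "x \<in> carrier Qt \<Longrightarrow> y \<in> carrier Qt \<Longrightarrow> monodromy x [(True, p y)] = x \<triangleright>\<^bsub>Qt\<^esub> y"
  using monodromy_word_map[of x "[(True, y)]"] by simp

lemma monodromy_qinv:
  "x \<in> carrier Qt \<Longrightarrow> y \<in> carrier Qt \<Longrightarrow> monodromy x [(False, p y)] = x \<triangleleft>\<^bsub>Qt\<^esub> y"
  using monodromy_word_map[of x "[(False, y)]"] by simp

lemma p_monodromy:
  "x \<in> carrier Qt \<Longrightarrow> w \<in> words (carrier Q) \<Longrightarrow> p (monodromy x w) = word_act Q (p x) w"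
  by (simp add: monodromy_def lift_word_words word_map_lift_word
      word_act_hom[OF source.quandle_axioms target.quandle_axioms hom])

text \<open>Lifting the two sides of the relator for \<open>a\<close> and \<open>b\<close> need not give a relator of \<open>Qt\<close>: the
  chosen preimage of \<open>a \<triangleright> b\<close> may differ from the product of those of \<open>a\<close> and \<open>b\<close>. The two translate
  \<open>Qt\<close> in the same way, which is all that is needed.\<close>

lemma monodromy_pres_eq:
  "pres_eq (carrier Q) (adj_relators Q) v w \<Longrightarrow> x \<in> carrier Qt \<Longrightarrow> monodromy x v = monodromy x w"
proof (induction arbitrary: x rule: pres_eq.induct)
  case (cancel u v a s)
  let ?y = "monodromy x u" and ?a = "inv_into (carrier Qt) p a"
  from cancel have "?y \<in> carrier Qt" "?a \<in> carrier Qt" "p ?a = a"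
    by (auto simp: monodromy_closed surj f_inv_into_f intro: inv_into_into)
  then have "monodromy ?y [(s, a), (\<not> s, a)] = ?y"
    by (cases s) (simp_all add: monodromy_def lift_word_def source.qop_qinv source.qinv_qop)
  then show ?case by (simp only: monodromy_append)
next
  case (rel u v l r)
  then obtain a b where ab: "a \<in> carrier Q" "b \<in> carrier Q"
    "l = [(True, a \<triangleright>\<^bsub>Q\<^esub> b)]" "r = [(False, b), (True, a), (True, b)]"
    by (auto simp: adj_relators_def)
  let ?y = "monodromy x u"
  from ab surj obtain a' b' where ab': "a' \<in> carrier Qt" "b' \<in> carrier Qt" "a = p a'" "b = p b'"
    by (metis imageE)
  have y: "?y \<in> carrier Qt" using rel by (simp add: monodromy_closed)
  have l: "l = word_map p [(True, a' \<triangleright>\<^bsub>Qt\<^esub> b')]"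
    using ab ab' hom by (simp add: quandle_hom_qop)
  have r: "r = word_map p [(False, b'), (True, a'), (True, b')]"
    using ab ab' by simp
  have "monodromy ?y l = ?y \<triangleright>\<^bsub>Qt\<^esub> (a' \<triangleright>\<^bsub>Qt\<^esub> b')"
    unfolding l using y ab' by (subst monodromy_word_map) auto
  also have "\<dots> = ((?y \<triangleleft>\<^bsub>Qt\<^esub> b') \<triangleright>\<^bsub>Qt\<^esub> a') \<triangleright>\<^bsub>Qt\<^esub> b'"
    using y ab' source.self_dist[of "?y \<triangleleft>\<^bsub>Qt\<^esub> b'" a' b'] by (simp add: source.qinv_qop)
  also have "\<dots> = monodromy ?y r"
    unfolding r using y ab' by (subst monodromy_word_map) auto
  finally show ?case by (simp only: monodromy_append)
qed auto

lemma monodromy_cancel_inv: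
  assumes "x \<in> carrier Qt" "w \<in> words (carrier Q)"
  shows "monodromy (monodromy x (word_inv w)) w = x"
  using monodromy_pres_eq[OF word_inv_cancel[OF assms(2)] assms(1)]
  by (simp add: monodromy_append) (simp add: monodromy_def lift_word_def)

lemmas Adj_map_p = Adj_map_class[OF source.quandle_axioms target.quandle_axioms hom]

text \<open>A word of \<open>Qt\<close> acts on \<open>Qt\<close> as its image under \<open>p\<close> does by monodromy. Conversely, a word whose
  monodromy fixes \<open>qt\<close> lifts, letter by letter, to a word of \<open>Qt\<close> of the same degree that
  fixes \<open>qt\<close>.\<close>

lemma pres_class_mem_pi1_image:
  assumes qt: "qt \<in> carrier Qt" and w: "w \<in> words (carrier Q)"
  shows "adj_class Q w \<in> pi1_map Qt qt Q p ` pi1 Qt qt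
    \<longleftrightarrow> exponent_sum w = 0 \<and> monodromy qt w = qt" (is "?L \<longleftrightarrow> ?R")
proof
  assume ?L
  then obtain v where v: "v \<in> words (carrier Qt)" "adj_class Qt v \<in> pi1 Qt qt"
    "adj_class Q w = Adj_map Q p (adj_class Qt v)"
    by (smt (verit) image_iff pi1_elem_word pi1_map_def restrict_apply)
  then have eq: "adj_class Q w = adj_class Q (word_map p v)"
    by (simp add: Adj_map_p)
  have v0: "exponent_sum v = 0" "word_act Qt qt v = qt"
    using v qt by (simp_all add: source.pi1_class)
  have "exponent_sum w = exponent_sum (word_map p v)"
    using eq Adj_eps_class[of w Q] Adj_eps_class[of "word_map p v" Q] w v
    by (simp add: word_map_words_p)
  moreover have "monodromy qt w = monodromy qt (word_map p v)"
    using eq w v qt by (intro monodromy_pres_eq) (simp_all add: pres_class_eq_iff word_map_words_p)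
  ultimately show ?R using v v0 qt by (simp add: monodromy_word_map)
next
  assume ?R
  then have "adj_class Qt (lift_word w) \<in> pi1 Qt qt"
    using w qt by (simp add: source.pi1_class lift_word_words)
      (simp add: monodromy_def lift_word_def)
  moreover from this have "pi1_map Qt qt Q p (adj_class Qt (lift_word w)) = adj_class Q w"
    using w by (simp add: pi1_map_def Adj_map_p lift_word_words word_map_lift_word)
  ultimately show ?L by (metis imageI)
qed

section \<open>Liftings\<close>

lemma lifting_eq_monodromy:
  assumes "is_lifting X x Qt qt p f g" "quandle X" "x \<in> carrier X" "w \<in> words (carrier X)"
  shows "g (word_act X x w) = monodromy qt (word_map f w)"
proof -
  have g: "g \<in> quandle_hom X Qt" "g x = qt" "\<And>y. y \<in> carrier X \<Longrightarrow> p (g y) = f y"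
    using assms(1) by (auto simp: is_lifting_def pointed_quandle_hom_def)
  have "g (word_act X x w) = word_act Qt qt (word_map g w)"
    using word_act_hom[OF assms(2) source.quandle_axioms g(1)] assms g by simp
  also have "\<dots> = monodromy qt (word_map p (word_map g w))"
    using assms g
    by (intro monodromy_word_map[symmetric] word_map_words) (auto simp: quandle_hom_def)
  also have "word_map p (word_map g w) = word_map f w"
    unfolding word_map_comp using assms(4) g by (intro word_map_cong) auto
  finally show ?thesis .
qed

lemma lifting_imp_pi1_subset:
  assumes lift: "is_lifting X x Qt qt p f g"
    and X: "quandle X" "x \<in> carrier X" and f: "f \<in> quandle_hom X Q"
  shows "pi1_map X x Q f ` pi1 X x \<subseteq> pi1_map Qt qt Q p ` pi1 Qt qt"
proof
  fix a assume "a \<in> pi1_map X x Q f ` pi1 X x"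
  then obtain w where w: "w \<in> words (carrier X)" "adj_class X w \<in> pi1 X x"
    "a = Adj_map Q f (adj_class X w)"
    by (smt (verit) image_iff pi1_elem_word pi1_map_def restrict_apply)
  have x: "exponent_sum w = 0" "word_act X x w = x"
    using w X by (simp_all add: quandle.pi1_class)
  have g: "g x = qt" "qt \<in> carrier Qt"
    using lift X by (auto simp: is_lifting_def pointed_quandle_hom_def quandle_hom_def)
  have "monodromy qt (word_map f w) = qt"
    using lifting_eq_monodromy[OF lift X w(1)] x g by simp
  moreover have "word_map f w \<in> words (carrier Q)"
    using w f by (intro word_map_words) (auto simp: quandle_hom_def)
  ultimately show "a \<in> pi1_map Qt qt Q p ` pi1 Qt qt"
    using w x g X f by (simp add: Adj_map_class target.quandle_axioms pres_class_mem_pi1_image)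
qed

lemma pi1_subset_imp_lifting:
  assumes sub: "pi1_map X x Q f ` pi1 X x \<subseteq> pi1_map Qt qt Q p ` pi1 Qt qt"
    and "connected_quandle X" and x: "x \<in> carrier X" and qt: "qt \<in> carrier Qt"
    and f: "f \<in> quandle_hom X Q" and base: "f x = p qt"
  shows "\<exists>g. is_lifting X x Qt qt p f g"
proof -
  interpret X: connected_quandle X by fact
  have fw: "word_map f w \<in> words (carrier Q)" if "w \<in> words (carrier X)" for w
    using that f by (intro word_map_words) (auto simp: quandle_hom_def)
  have loop: "monodromy qt (word_map f w) = qt"
    if "w \<in> words (carrier X)" "exponent_sum w = 0" "word_act X x w = x" for w
  proof -
    have "adj_class X w \<in> pi1 X x" using that x by (simp add: X.pi1_class)
    moreover from this have "pi1_map X x Q f (adj_class X w) = adj_class Q (word_map f w)"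
      using that f by (simp add: pi1_map_def Adj_map_class X.quandle_axioms target.quandle_axioms)
    ultimately have "adj_class Q (word_map f w) \<in> pi1_map Qt qt Q p ` pi1 Qt qt"
      using sub by (metis imageI subsetD)
    then show ?thesis using that fw qt by (simp add: pres_class_mem_pi1_image)
  qed
  have endpoint: "monodromy qt (word_map f v) = monodromy qt (word_map f w)"
    if v: "v \<in> words (carrier X)" "exponent_sum v = 0"
      and w: "w \<in> words (carrier X)" "exponent_sum w = 0"
      and eq: "word_act X x v = word_act X x w" for v w
  proof -
    have "monodromy qt (word_map f (v @ word_inv w)) = qt"
      using v w x eq by (intro loop) (simp_all add: word_inv_words X.word_act_append X.word_act_cancel_inv)
    then have "monodromy (monodromy qt (word_map f v)) (word_inv (word_map f w)) = qt"
      by (simp add: monodromy_append word_map_word_inv)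
    moreover have "monodromy (monodromy (monodromy qt (word_map f v)) (word_inv (word_map f w)))
        (word_map f w) = monodromy qt (word_map f v)"
      using qt v w by (simp add: monodromy_cancel_inv monodromy_closed fw)
    ultimately show ?thesis by simp
  qed
  define path where "path y = (SOME w. w \<in> words (carrier X) \<and> exponent_sum w = 0 \<and>
    word_act X x w = y)" for y
  have path: "path y \<in> words (carrier X)" "exponent_sum (path y) = 0" "word_act X x (path y) = y"
    if "y \<in> carrier X" for y
    using someI_ex[of "\<lambda>w. w \<in> words (carrier X) \<and> exponent_sum w = 0 \<and> word_act X x w = y"]
      X.degree_zero_word[OF x that] unfolding path_def by metis+
  define g where "g y = monodromy qt (word_map f (path y))" for y
  have g_eq: "g y = monodromy qt (word_map f w)"
    if "w \<in> words (carrier X)" "exponent_sum w = 0" "word_act X x w = y" for w y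
  proof -
    have "y \<in> carrier X" using that x X.word_act_closed by blast
    then show ?thesis unfolding g_def using that path by (intro endpoint) auto
  qed
  have g_closed: "g y \<in> carrier Qt" if "y \<in> carrier X" for y
    using that path qt by (simp add: g_def monodromy_closed fw)
  have p_g: "p (g y) = f y" if "y \<in> carrier X" for y
    using that path qt x f base word_act_hom[OF X.quandle_axioms target.quandle_axioms f x, of "path y"]
    by (simp add: g_def p_monodromy fw)
  have "g (y \<triangleright>\<^bsub>X\<^esub> z) = g y \<triangleright>\<^bsub>Qt\<^esub> g z" if y: "y \<in> carrier X" and z: "z \<in> carrier X" for y z
  proof -
    \<comment> \<open>The leading letter \<open>x\<inverse>\<close> brings the degree back to zero; it fixes \<open>x\<close> and \<open>qt\<close>.\<close>
    let ?w = "[(False, x)] @ path y @ [(True, z)]"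
    have "word_act X x ?w = y \<triangleright>\<^bsub>X\<^esub> z"
      using path[OF y] x by (simp add: X.qinv_self X.word_act_append)
    then have "g (y \<triangleright>\<^bsub>X\<^esub> z) = monodromy qt (word_map f ?w)"
      using path[OF y] x z by (intro g_eq) auto
    also have "\<dots> = monodromy (monodromy (monodromy qt [(False, p qt)]) (word_map f (path y)))
        [(True, p (g z))]"
      using base p_g[OF z] by (simp flip: monodromy_append)
    also have "monodromy qt [(False, p qt)] = qt"
      using qt by (simp add: monodromy_qinv source.qinv_self)
    also have "monodromy qt (word_map f (path y)) = g y"
      by (simp add: g_def)
    also have "monodromy (g y) [(True, p (g z))] = g y \<triangleright>\<^bsub>Qt\<^esub> g z"
      using y z by (simp add: monodromy_qop g_closed)
    finally show ?thesis .
  qed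
  moreover have "g x = qt"
    using g_eq[of "[]" x] by (simp add: monodromy_def lift_word_def)
  ultimately have "is_lifting X x Qt qt p f g"
    using g_closed p_g by (auto simp: is_lifting_def pointed_quandle_hom_def quandle_hom_def)
  then show ?thesis by (rule exI[where x = g])
qed

lemma lifting_unique:
  assumes "is_lifting X x Qt qt p f g" "is_lifting X x Qt qt p f h"
    and "connected_quandle X" "x \<in> carrier X" "y \<in> carrier X"
  shows "g y = h y"
proof -
  interpret X: connected_quandle X by fact
  obtain w where w: "w \<in> words (carrier X)" "word_act X x w = y"
    using X.degree_zero_word assms(4,5) by metis
  show ?thesis
    using lifting_eq_monodromy[OF assms(1) X.quandle_axioms assms(4) w(1)]
      lifting_eq_monodromy[OF assms(2) X.quandle_axioms assms(4) w(1)] w(2) by simp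
qed

end

theorem proposition1p9:
  fixes Qt :: "'b quandle" and Q :: "'a quandle" and X :: "'c quandle"
  assumes "pointed_quandle Qt qt" and "pointed_quandle Q q"
    and "quandle_covering Qt Q p" and "p \<in> pointed_quandle_hom Qt qt Q q"
    and "pointed_quandle X x" and "connected_quandle X"
    and "f \<in> pointed_quandle_hom X x Q q"
  shows "((\<exists>ft. is_lifting X x Qt qt p f ft) \<longleftrightarrow>
           pi1_map X x Q f ` pi1 X x \<subseteq> pi1_map Qt qt Q p ` pi1 Qt qt)
         \<and> (\<forall>ft gt. is_lifting X x Qt qt p f ft \<longrightarrow> is_lifting X x Qt qt p f gt \<longrightarrow>
              (\<forall>y \<in> carrier X. ft y = gt y))"
proof -
  interpret quandle_covering Qt Q p by fact
  have X: "quandle X" "x \<in> carrier X" and qt: "qt \<in> carrier Qt"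
    using assms by (simp_all add: pointed_quandle_def pointed_quandle_axioms_def)
  have f: "f \<in> quandle_hom X Q" and base: "f x = p qt"
    using assms by (auto simp: pointed_quandle_hom_def)
  have "(\<exists>ft. is_lifting X x Qt qt p f ft) \<longleftrightarrow>
      pi1_map X x Q f ` pi1 X x \<subseteq> pi1_map Qt qt Q p ` pi1 Qt qt"
  proof
    assume "\<exists>ft. is_lifting X x Qt qt p f ft"
    then obtain ft where "is_lifting X x Qt qt p f ft" ..
    from lifting_imp_pi1_subset[OF this X f]
    show "pi1_map X x Q f ` pi1 X x \<subseteq> pi1_map Qt qt Q p ` pi1 Qt qt" .
  qed (rule pi1_subset_imp_lifting[OF _ \<open>connected_quandle X\<close> X(2) qt f base])
  moreover have "\<forall>ft gt. is_lifting X x Qt qt p f ft \<longrightarrow> is_lifting X x Qt qt p f gt \<longrightarrow>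
      (\<forall>y \<in> carrier X. ft y = gt y)"
    by (intro allI impI ballI) (rule lifting_unique[OF _ _ \<open>connected_quandle X\<close> X(2)])
  ultimately show ?thesis by (rule conjI)
qed

end
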